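(* For all integers $k \geq 3$ and $n\ge 2k-1$, there exists a $k$-graph $H$ on $n$ vertices such that $\delta_{k-1}(H) \geq \left\lceil\frac{n}{2k-2}\right\rceil-1$ but $H$ does not contain a Hamilton cycle.
   Context: A $k$-uniform hypergraph, or $k$-graph, $H$ consists of a vertex set $V$ and a set of edges, each of which is a set of $k$ vertices. For $T\in\binom{V}{k-1}$, its neighbourhood is $N_H(T)=\{x\in V:\{x\}\cup T\in H\}$ and its degree is $d_{k-1}(T)=|N_H(T)|$. The minimum degree of $H$ is $\delta_{k-1}(H)=\min\{d_{k-1}(T):T\in\binom{V}{k-1}\}$. A $k$-graph $C$ is a cycle of order $n$ if its vertices can be given a cyclic ordering $v_1,\dots,v_n$ so that every consecutive pair $v_i,v_{i+1}$ (indices modulo $n$) lies in an edge of $C$ and every edge of $C$ consists of $k$ consecutive vertices. A Hamilton cycle in a $k$-graph $H$ is a sub-$k$-graph of $H$ which is a cycle (of any kind, not necessarily loose or tight) containing every vertex of $H$. *)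

theory Defs
  imports Complex_Main
begin

record 'a hypergraph =
  verts :: "'a set"
  edges :: "'a set set"

definition k_graph :: "nat \<Rightarrow> 'a hypergraph \<Rightarrow> bool" where
  "k_graph k H \<longleftrightarrow> finite (verts H) \<and> (\<forall>e \<in> edges H. e \<subseteq> verts H \<and> card e = k)"

definition neighbourhood :: "'a hypergraph \<Rightarrow> 'a set \<Rightarrow> 'a set" where
  "neighbourhood H T = {x \<in> verts H. {x} \<union> T \<in> edges H}"

definition degree :: "'a hypergraph \<Rightarrow> 'a set \<Rightarrow> nat" where
  "degree H T = card (neighbourhood H T)"

text \<open>The minimum of the degrees of the \<open>(k - 1)\<close>-sets of vertices. It is meaningful
  only when \<open>1 \<le> k\<close> and there are at least \<open>k - 1\<close> vertices; otherwise \<open>k - 1\<close> truncates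
  or \<open>Min\<close> is taken over the empty set.\<close>

definition min_degree :: "nat \<Rightarrow> 'a hypergraph \<Rightarrow> nat" where
  "min_degree k H = Min {degree H T | T. T \<subseteq> verts H \<and> card T = k - 1}"

text \<open>The cyclic ordering is an enumeration \<open>v 0, \<dots>, v (n - 1)\<close> of the vertices, with
  indices read modulo \<open>n\<close>. Edges need not overlap in any prescribed number of vertices.\<close>

definition is_cycle :: "nat \<Rightarrow> nat \<Rightarrow> 'a hypergraph \<Rightarrow> bool" where
  "is_cycle k n C \<longleftrightarrow> k_graph k C \<and>
     (\<exists>v. bij_betw v {..<n} (verts C) \<and>
          (\<forall>i<n. \<exists>e \<in> edges C. {v i, v ((i + 1) mod n)} \<subseteq> e) \<and>
          (\<forall>e \<in> edges C. \<exists>i<n. e = {v ((i + j) mod n) | j. j < k}))"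

definition sub_hypergraph :: "'a hypergraph \<Rightarrow> 'a hypergraph \<Rightarrow> bool" where
  "sub_hypergraph C H \<longleftrightarrow> verts C \<subseteq> verts H \<and> edges C \<subseteq> edges H"

definition hamilton_cycle :: "nat \<Rightarrow> 'a hypergraph \<Rightarrow> 'a hypergraph \<Rightarrow> bool" where
  "hamilton_cycle k C H \<longleftrightarrow>
     sub_hypergraph C H \<and> (\<exists>n. is_cycle k n C) \<and> verts H \<subseteq> verts C"

end

theory Submission
  imports Defs "HOL-Number_Theory.Cong"
begin

text \<open>
  Fix a small set \<open>A\<close> of vertices and take as edges all \<open>k\<close>-sets that meet \<open>A\<close>. A
  \<open>(k - 1)\<close>-set \<open>T\<close> that avoids \<open>A\<close> is completed to an edge by each vertex of \<open>A\<close>, and one that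
  meets \<open>A\<close> by each vertex outside \<open>T\<close>, so the minimum degree is at least \<open>card A\<close> as long as
  \<open>card A \<le> n - (k - 1)\<close> (\<open>min_degree_meeting_hypergraph\<close>).

  On the other hand, no cycle of order \<open>n\<close> can have all its edges meeting too small a set. An edge
  through a vertex \<open>a\<close> lies within distance \<open>k - 1\<close> of \<open>a\<close> along the cycle, so all edges
  through \<open>a\<close> together cover at most the \<open>2 * k - 2\<close> consecutive pairs inside that window. Since all
  \<open>n\<close> consecutive pairs are covered, \<open>n \<le> card A * (2 * k - 2)\<close>
  (\<open>cycle_order_le_transversal\<close>). The largest \<open>A\<close> that violates this bound has
  \<open>(n - 1) div (2 * k - 2)\<close> elements, which is \<open>\<lceil>n / (2 * k - 2)\<rceil> - 1\<close>.
\<close>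

definition meeting_hypergraph :: "nat \<Rightarrow> 'a set \<Rightarrow> 'a set \<Rightarrow> 'a hypergraph" where
  "meeting_hypergraph k V A =
     \<lparr>verts = V, edges = {e. e \<subseteq> V \<and> card e = k \<and> e \<inter> A \<noteq> {}}\<rparr>"

lemma k_graph_meeting_hypergraph: "finite V \<Longrightarrow> k_graph k (meeting_hypergraph k V A)"
  by (simp add: k_graph_def meeting_hypergraph_def)

lemma degree_meeting_hypergraph:
  assumes "finite V" "A \<subseteq> V" "k \<ge> 1" "card A \<le> card V - (k - 1)"
    and T: "T \<subseteq> V" "card T = k - 1"
  shows "card A \<le> degree (meeting_hypergraph k V A) T"
proof -
  let ?N = "neighbourhood (meeting_hypergraph k V A) T"
  have "finite T"
    using T(1) assms(1) by (rule finite_subset)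
  have fin: "finite ?N"
    using assms(1) by (rule finite_subset[rotated])
      (auto simp: neighbourhood_def meeting_hypergraph_def)
  have new: "card (insert x T) = k" if "x \<notin> T" for x
    using that \<open>finite T\<close> T(2) assms(3) by simp
  show ?thesis
  proof (cases "T \<inter> A = {}")
    case True
    then have "A \<subseteq> ?N"
      using new T(1) assms(2) by (auto simp: neighbourhood_def meeting_hypergraph_def)
    then show ?thesis
      unfolding degree_def using fin by (rule card_mono[rotated])
  next
    case False
    then have "V - T \<subseteq> ?N"
      using new T(1) by (auto simp: neighbourhood_def meeting_hypergraph_def)
    then have "card (V - T) \<le> card ?N"
      using fin by (rule card_mono[rotated])
    moreover have "card (V - T) = card V - (k - 1)"
      using T \<open>finite T\<close> by (simp add: card_Diff_subset)
    ultimately show ?thesis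
      unfolding degree_def using assms(4) by linarith
  qed
qed

lemma min_degree_meeting_hypergraph:
  assumes "finite V" "A \<subseteq> V" "k \<ge> 1" "card A \<le> card V - (k - 1)" "k - 1 \<le> card V"
  shows "card A \<le> min_degree k (meeting_hypergraph k V A)"
proof -
  let ?H = "meeting_hypergraph k V A"
  let ?D = "{degree ?H T | T. T \<subseteq> verts ?H \<and> card T = k - 1}"
  have V: "verts ?H = V"
    by (simp add: meeting_hypergraph_def)
  have "finite {T. T \<subseteq> V \<and> card T = k - 1}"
    using assms(1) by simp
  then have "finite ?D"
    unfolding V by (rule finite_image_set)
  moreover obtain T where "T \<subseteq> V" "card T = k - 1"
    using assms(5) by (meson obtain_subset_with_card_n)
  then have "?D \<noteq> {}"
    unfolding V by blast
  moreover have "\<forall>d\<in>?D. card A \<le> d"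
    unfolding V using degree_meeting_hypergraph[OF assms(1-4)] by blast
  ultimately show ?thesis
    unfolding min_degree_def by simp
qed

text \<open>The first vertex of a covered pair cannot be the last of the \<open>k\<close> positions of the edge, since
  \<open>k < n\<close> keeps the edge from closing up on itself. Hence it lies between \<open>k - 1\<close> places before and
  \<open>k - 2\<close> places after any given vertex of that edge, which leaves \<open>2 * k - 2\<close> choices for it.\<close>

lemma cycle_order_le_transversal:
  assumes cyc: "is_cycle k n C" and "k < n"
    and A: "finite A" and meets: "\<And>e. e \<in> edges C \<Longrightarrow> e \<inter> A \<noteq> {}"
  shows "n \<le> card A * (2 * k - 2)"
proof -
  obtain v where v: "bij_betw v {..<n} (verts C)"
    and pairs: "\<forall>i<n. \<exists>e \<in> edges C. {v i, v ((i + 1) mod n)} \<subseteq> e"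
    and segs: "\<forall>e \<in> edges C. \<exists>s<n. e = {v ((s + j) mod n) | j. j < k}"
    using cyc unfolding is_cycle_def by (elim conjE exE) (rule that)
  have "n > 0"
    using \<open>k < n\<close> by simp
  have inj: "inj_on v {..<n}"
    using v by (rule bij_betw_imp_inj_on)
  have v_inj: "x = y" if "v x = v y" "x < n" "y < n" for x y
    using inj that by (auto dest: inj_onD)
  define P where "P = {p \<in> {..<n}. v p \<in> A}"
  have "card P \<le> card A"
    using A by (intro card_inj_on_le[of v]) (auto simp: P_def intro: inj_on_subset[OF inj])
  \<comment> \<open>The summand \<open>n - (k - 1)\<close> is a shift by \<open>k - 1\<close> places backwards modulo \<open>n\<close>.\<close>
  define g where "g = (\<lambda>(p, d). (p + d + (n - (k - 1))) mod n)"
  have "{..<n} \<subseteq> g ` (P \<times> {..<2 * k - 2})"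
  proof
    fix i assume "i \<in> {..<n}"
    then have i: "i < n"
      by simp
    obtain e where e: "e \<in> edges C" "v i \<in> e" "v ((i + 1) mod n) \<in> e"
      using pairs i by blast
    obtain s where s: "e = {v ((s + j) mod n) | j. j < k}"
      using bspec[OF segs e(1)] by blast
    obtain j where j: "j < k" "v i = v ((s + j) mod n)"
      using e(2) s by blast
    obtain j' where j': "j' < k" "v ((i + 1) mod n) = v ((s + j') mod n)"
      using e(3) s by blast
    obtain l where l: "l < k" "v ((s + l) mod n) \<in> A"
      using meets[OF e(1)] s by blast
    have i_eq: "i = (s + j) mod n"
      using v_inj[OF j(2)] i \<open>n > 0\<close> by simp
    have "(i + 1) mod n = (s + j') mod n"
      using v_inj[OF j'(2)] \<open>n > 0\<close> by simp
    then have "(s + (j + 1)) mod n = (s + j') mod n"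
      unfolding i_eq by (simp add: mod_simps)
    then have "[s + (j + 1) = s + j'] (mod n)"
      by (simp add: cong_def)
    then have "(j + 1) mod n = j' mod n"
      unfolding cong_add_lcancel_nat by (simp add: cong_def)
    then have "j + 1 = j'"
      using j(1) j'(1) \<open>k < n\<close> by simp
    then have "j + 1 < k"
      using j'(1) by simp
    define d where "d = j + (k - 1) - l"
    have "d < 2 * k - 2"
      unfolding d_def using \<open>j + 1 < k\<close> l(1) by linarith
    moreover have "(s + l) mod n \<in> P"
      unfolding P_def using l(2) \<open>n > 0\<close> by simp
    moreover have "g ((s + l) mod n, d) = i"
    proof -
      have "g ((s + l) mod n, d) = ((s + l) + d + (n - (k - 1))) mod n"
        unfolding g_def by (simp add: mod_simps add.assoc)
      also have "(s + l) + d + (n - (k - 1)) = s + j + n"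
        unfolding d_def using l(1) \<open>k < n\<close> by linarith
      finally show ?thesis
        using i_eq by simp
    qed
    ultimately show "i \<in> g ` (P \<times> {..<2 * k - 2})"
      by (intro image_eqI[of _ _ "((s + l) mod n, d)"]) auto
  qed
  then have "card {..<n} \<le> card (P \<times> {..<2 * k - 2})"
    by (rule surj_card_le[rotated]) (simp add: P_def)
  also have "\<dots> = card P * (2 * k - 2)"
    by (simp add: card_cartesian_product)
  also have "\<dots> \<le> card A * (2 * k - 2)"
    using \<open>card P \<le> card A\<close> by simp
  finally show ?thesis
    by simp
qed

lemma no_hamilton_cycle_meeting_hypergraph:
  assumes "finite A" "k < card V" "card A * (2 * k - 2) < card V"
  shows "\<not> hamilton_cycle k C (meeting_hypergraph k V A)"
proof
  assume ham: "hamilton_cycle k C (meeting_hypergraph k V A)"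
  then obtain n where cyc: "is_cycle k n C"
    unfolding hamilton_cycle_def by blast
  have "verts C = V"
    using ham by (auto simp: hamilton_cycle_def sub_hypergraph_def meeting_hypergraph_def)
  moreover obtain v where "bij_betw v {..<n} (verts C)"
    using cyc unfolding is_cycle_def by blast
  ultimately have n: "n = card V"
    using bij_betw_same_card by fastforce
  have "e \<inter> A \<noteq> {}" if "e \<in> edges C" for e
    using ham that by (auto simp: hamilton_cycle_def sub_hypergraph_def meeting_hypergraph_def)
  then have "n \<le> card A * (2 * k - 2)"
    using cyc assms n by (intro cycle_order_le_transversal) auto
  then show False
    using assms(3) n by simp
qed

theorem proposition2p1:
  fixes k n :: nat
  assumes "k \<ge> 3" and "n \<ge> 2 * k - 1"
  shows "\<exists>H :: nat hypergraph. k_graph k H \<and> card (verts H) = n \<and>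
           int (min_degree k H) \<ge> \<lceil>real n / (2 * real k - 2)\<rceil> - 1 \<and>
           \<not> (\<exists>C. hamilton_cycle k C H)"
proof -
  define w where "w = 2 * k - 2"
  define m where "m = (n - 1) div w"
  define H where "H = meeting_hypergraph k {..<n} {..<m}"
  have w: "w \<ge> 4" "real w = 2 * real k - 2"
    using assms(1) by (auto simp: w_def)
  have n: "n = m * w + (n - 1) mod w + 1"
    using assms unfolding m_def by simp
  have mw: "m * w < n"
    using n by linarith
  have "n \<le> (m + 1) * w"
    using n w(1) mod_less_divisor[of w "n - 1"] unfolding add_mult_distrib by linarith
  then have "real n \<le> (real m + 1) * real w"
    by (metis of_nat_1 of_nat_add of_nat_le_iff of_nat_mult)
  then have "real n / real w \<le> real m + 1"
    using w(1) by (simp add: divide_le_eq)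
  then have m_ge: "\<lceil>real n / (2 * real k - 2)\<rceil> - 1 \<le> int m"
    unfolding w(2) by linarith
  \<comment> \<open>As \<open>k - 1 \<le> n / 2\<close>, at least half of the vertices lie outside a \<open>(k - 1)\<close>-set, while \<open>m \<le> n / 2\<close>.\<close>
  have "2 * m \<le> m * w"
    using w(1) by simp
  then have m_le: "m \<le> n - (k - 1)"
    using mw assms by linarith
  have "m \<le> min_degree k H"
    using min_degree_meeting_hypergraph[of "{..<n}" "{..<m}" k] m_le assms
    unfolding H_def by fastforce
  moreover have "\<not> hamilton_cycle k C H" for C
    using no_hamilton_cycle_meeting_hypergraph[of "{..<m}" k "{..<n}" C] mw assms
    unfolding H_def w_def by simp
  moreover have "k_graph k H"
    unfolding H_def by (simp add: k_graph_meeting_hypergraph)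
  moreover have "card (verts H) = n"
    by (simp add: H_def meeting_hypergraph_def)
  ultimately show ?thesis
    using m_ge by (intro exI[of _ H]) auto
qed

end
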